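(* Let $n$ be a positive integer. The following system in the variables $x_1,\ldots,x_{n+10}$: \[ \begin{array}{rcl} x_i \cdot x_i & = & x_{i+1} \quad \text{for every } i \in \{1,\ldots,n\},\\ x_1 \cdot x_{n+1} & = & x_{n+2},\\ x_{n+3} & = & 1,\\ x_{n+3}+x_{n+3} & = & x_{n+4},\\ x_{n+4}+x_{n+4} & = & x_{n+5},\\ x_{n+5}+x_{n+3} & = & x_1,\\ x_{n+6} \cdot x_{n+6} & = & x_{n+7},\\ x_{n+8} \cdot x_{n+8} & = & x_{n+9},\\ x_{n+9}+x_{n+3} & = & x_{n+10},\\ x_{n+2} \cdot x_{n+7} & = & x_{n+10} \end{array} \] has infinitely many solutions in non-negative integers $x_1,\ldots,x_{n+10}$. Moreover, if an integer tuple $(x_1,\ldots,x_{n+10})$ solves the system, then \[ x_{n+10} \geq \left(\frac{\left(2+\sqrt{5}\right)^{5^{2^{n-1}}}+\left(2-\sqrt{5}\right)^{5^{2^{n-1}}}}{2}\right)^2+1 . \] *)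

theory Defs
  imports Complex_Main "HOL-Library.FuncSet"
begin

text \<open>
  A tuple \<open>(x\<^sub>1, \<dots>, x\<^sub>m)\<close> with entries in \<open>A\<close> is an element of
  \<open>{1..m} \<rightarrow>\<^sub>E A\<close>. Extensionality makes distinct functions distinct tuples, so that
  counting functions is counting tuples.
\<close>

definition tuples :: "nat \<Rightarrow> int set \<Rightarrow> (nat \<Rightarrow> int) set" where
  "tuples m A = {1..m} \<rightarrow>\<^sub>E A"

definition solves_system :: "nat \<Rightarrow> (nat \<Rightarrow> int) \<Rightarrow> bool" where
  "solves_system n x \<longleftrightarrow>
     (\<forall>i\<in>{1..n}. x i * x i = x (i + 1)) \<and>
     x 1 * x (n + 1) = x (n + 2) \<and>
     x (n + 3) = 1 \<and>
     x (n + 3) + x (n + 3) = x (n + 4) \<and>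
     x (n + 4) + x (n + 4) = x (n + 5) \<and>
     x (n + 5) + x (n + 3) = x 1 \<and>
     x (n + 6) * x (n + 6) = x (n + 7) \<and>
     x (n + 8) * x (n + 8) = x (n + 9) \<and>
     x (n + 9) + x (n + 3) = x (n + 10) \<and>
     x (n + 2) * x (n + 7) = x (n + 10)"

end

theory Submission imports Defs "HOL-Number_Theory.Cong" begin

text \<open>
  The system forces \<open>x\<^sub>i = 5^(2^(i-1))\<close> for \<open>i \<le> n + 1\<close>, so that with
  \<open>m = 2^(n-1)\<close>, \<open>a = x\<^bsub>n+6\<^esub>\<close>, \<open>b = x\<^bsub>n+8\<^esub>\<close> it amounts to the negative Pell equation
  \<open>b\<^sup>2 - 5 (5^m a)\<^sup>2 = -1\<close>. Its non-negative solutions are given by the odd powers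
  \<open>(2 + \<surd>5)^k = p\<^sub>k + q\<^sub>k \<surd>5\<close>. Since \<open>q\<^bsub>5k\<^esub> = 5 q\<^sub>k u\<close> with \<open>u\<close> prime to \<open>5\<close>, and
  \<open>5\<close> divides \<open>q\<^sub>k\<close> only if it divides \<open>k\<close>, we have \<open>5^m dvd q\<^sub>k\<close> if and only if
  \<open>5^m dvd k\<close>. Hence the admissible indices are the odd multiples of \<open>5^m\<close>, the least of
  which is \<open>5^m\<close> itself.
\<close>

section \<open>Powers of the unit \<open>2 + sqrt 5\<close> and the Pell equation\<close>

fun pell_p :: "nat \<Rightarrow> int" and pell_q :: "nat \<Rightarrow> int" where
  "pell_p 0 = 1"
| "pell_p (Suc k) = 2 * pell_p k + 5 * pell_q k"
| "pell_q 0 = 0"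
| "pell_q (Suc k) = pell_p k + 2 * pell_q k"

lemma pell_pos_nonneg: "pell_p k > 0 \<and> pell_q k \<ge> 0"
  by (induction k) auto

lemma pell_p_pos: "pell_p k > 0" and pell_q_nonneg: "pell_q k \<ge> 0"
  using pell_pos_nonneg by auto

lemma pell_norm: "(pell_p k)\<^sup>2 - 5 * (pell_q k)\<^sup>2 = (-1) ^ k"
proof (induction k)
  case (Suc k)
  have "(pell_p (Suc k))\<^sup>2 - 5 * (pell_q (Suc k))\<^sup>2 = - ((pell_p k)\<^sup>2 - 5 * (pell_q k)\<^sup>2)"
    by (simp add: power2_eq_square algebra_simps)
  then show ?case using Suc by simp
qed simp

lemma strict_mono_pell_p: "strict_mono pell_p"
unfolding strict_mono_Suc_iff
proof
  fix k show "pell_p k < pell_p (Suc k)"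
    using pell_p_pos[of k] pell_q_nonneg[of k] by simp
qed

lemma pell_power_plus: "(2 + sqrt 5) ^ k = real_of_int (pell_p k) + real_of_int (pell_q k) * sqrt 5"
  by (induction k) (simp_all add: algebra_simps)

lemma pell_power_minus: "(2 - sqrt 5) ^ k = real_of_int (pell_p k) - real_of_int (pell_q k) * sqrt 5"
proof (induction k)
  case (Suc k)
  show ?case unfolding power_Suc Suc by (simp add: algebra_simps)
qed simp

lemma pell_p_closed_form: "real_of_int (pell_p k) = ((2 + sqrt 5) ^ k + (2 - sqrt 5) ^ k) / 2"
  by (simp add: pell_power_plus pell_power_minus)

text \<open>Descent: dividing \<open>b + y \<surd>5\<close> by the fundamental unit \<open>2 + \<surd>5\<close> decreases \<open>y\<close>.\<close>

lemma pell_solution_exists_index: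
  fixes b y :: int
  assumes "b \<ge> 0" "y \<ge> 0" "\<bar>b\<^sup>2 - 5 * y\<^sup>2\<bar> = 1"
  shows "\<exists>k. b = pell_p k \<and> y = pell_q k"
  using assms
proof (induction "nat y" arbitrary: b y rule: less_induct)
  case less
  show ?case
  proof (cases "y = 0")
    case True
    then have "b\<^sup>2 = 1" using less.prems by simp
    then have "b = 1" using less.prems(1) by (simp add: power2_eq_1_iff)
    then show ?thesis using True by (intro exI[of _ 0]) simp
  next
    case False
    then have y1: "y \<ge> 1" using less.prems by simp
    then have yy: "y\<^sup>2 \<ge> 1" by (simp add: one_le_power)
    have b2: "b\<^sup>2 \<le> 5 * y\<^sup>2 + 1" "b\<^sup>2 \<ge> 5 * y\<^sup>2 - 1" using less.prems(3) by linarith+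
    \<comment> \<open>The bounds \<open>2 * y \<le> b < 3 * y\<close> place \<open>b - 2 * y\<close>
      in the range from 0 to \<open>y - 1\<close>; \<open>2 * b \<le> 5 * y\<close> keeps the other
      new coordinate non-negative.\<close>
    have "(2 * y)\<^sup>2 \<le> b\<^sup>2" using b2 yy by (simp add: power_mult_distrib)
    then have ge: "2 * y \<le> b" using less.prems(1) by (rule power2_le_imp_le)
    have "b\<^sup>2 < (3 * y)\<^sup>2" using b2 yy by (simp add: power_mult_distrib)
    then have lt: "b < 3 * y" by (rule power2_less_imp_less) (use y1 in simp)
    have "(2 * b)\<^sup>2 \<le> (5 * y)\<^sup>2" using b2 yy by (simp add: power_mult_distrib)
    then have ge': "2 * b \<le> 5 * y" by (rule power2_le_imp_le) (use y1 in simp)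
    \<comment> \<open>The new pair comes from multiplying by \<open>sqrt 5 - 2\<close>, the inverse
      of \<open>2 + sqrt 5\<close>. It has norm -1, so the sign flips at each descent; hence the
      absolute value in the hypothesis.\<close>
    have "(5 * y - 2 * b)\<^sup>2 - 5 * (b - 2 * y)\<^sup>2 = - (b\<^sup>2 - 5 * y\<^sup>2)"
      by (simp add: power2_eq_square algebra_simps)
    then have "\<bar>(5 * y - 2 * b)\<^sup>2 - 5 * (b - 2 * y)\<^sup>2\<bar> = 1"
      using less.prems(3) by simp
    moreover have "nat (b - 2 * y) < nat y" using lt ge y1 by linarith
    ultimately obtain k where "5 * y - 2 * b = pell_p k" "b - 2 * y = pell_q k"
      using less.hyps[of "b - 2 * y" "5 * y - 2 * b"] ge ge' by auto
    then show ?thesis by (intro exI[of _ "Suc k"]) simp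
  qed
qed

section \<open>Divisibility of \<open>pell_q\<close> by powers of 5\<close>

lemma pell_add:
  "pell_p (j + k) = pell_p j * pell_p k + 5 * pell_q j * pell_q k \<and>
   pell_q (j + k) = pell_p j * pell_q k + pell_q j * pell_p k"
  by (induction j) (simp_all add: algebra_simps)

text \<open>This is the coefficient of \<open>sqrt 5\<close> in the fifth power of
  \<open>pell_p k + pell_q k * sqrt 5\<close>.\<close>

lemma pell_q_times5:
  "pell_q (5 * k) = 5 * pell_q k *
     ((pell_p k) ^ 4 + 10 * (pell_p k)\<^sup>2 * (pell_q k)\<^sup>2 + 5 * (pell_q k) ^ 4)"
proof -
  have "5 * k = k + (k + (k + (k + k)))" by simp
  then show ?thesis
    by (simp only: pell_add) (simp add: power2_eq_square power4_eq_xxxx algebra_simps)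
qed

text \<open>Modulo 5 the square of \<open>sqrt 5\<close> vanishes, so only the first two binomial
  terms of \<open>(2 + sqrt 5) ^ k\<close> survive. Doubling \<open>pell_q k\<close> avoids the
  exponent \<open>k - 1\<close>.\<close>

lemma pell_q_mod_5: "[2 * pell_q k = int k * 2 ^ k] (mod 5) \<and> [pell_p k = 2 ^ k] (mod 5)"
proof (induction k)
  case (Suc k)
  then have p: "[pell_p k = 2 ^ k] (mod 5)" and q: "[2 * pell_q k = int k * 2 ^ k] (mod 5)" by auto
  have "[2 * pell_p k + 2 * (2 * pell_q k) = 2 * 2 ^ k + 2 * (int k * 2 ^ k)] (mod 5)"
    by (intro cong_add cong_mult p q cong_refl)
  moreover have "[2 * pell_p k + 5 * pell_q k = 2 * 2 ^ k + 0] (mod 5)"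
    by (intro cong_add cong_mult p cong_refl) (simp add: cong_0_iff)
  ultimately show ?case by (simp add: algebra_simps)
qed simp

lemma five_dvd_pell_q_imp:
  assumes "5 dvd pell_q k"
  shows "5 dvd k"
proof -
  have "5 dvd int k * 2 ^ k"
    using pell_q_mod_5[of k] assms cong_dvd_iff[of "2 * pell_q k" "int k * 2 ^ k" 5] by auto
  moreover have "coprime (5::int) (2 ^ k)"
    by simp
  ultimately have "5 dvd int k"
    by (simp add: coprime_dvd_mult_left_iff)
  then show ?thesis by presburger
qed

lemma coprime_5_pell_p: "coprime 5 (pell_p k)"
proof -
  have "[pell_p k = 2 ^ k] (mod 5)" using pell_q_mod_5 by blast
  moreover have "coprime (5::int) (2 ^ k)"
    by simp
  ultimately show ?thesis
    by (metis cong_imp_coprime cong_sym coprime_commute)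
qed

lemma five_power_dvd_pell_q_times5_iff:
  "5 ^ Suc m dvd pell_q (5 * k) \<longleftrightarrow> 5 ^ m dvd pell_q k"
proof -
  let ?u = "(pell_p k) ^ 4 + 10 * (pell_p k)\<^sup>2 * (pell_q k)\<^sup>2 + 5 * (pell_q k) ^ 4"
  have "?u = pell_p k ^ 4 + 5 * (2 * (pell_p k)\<^sup>2 * (pell_q k)\<^sup>2 + (pell_q k) ^ 4)"
    by (simp add: algebra_simps)
  then have "[?u = pell_p k ^ 4] (mod 5)"
    by (simp only: cong_iff_dvd_diff) simp
  moreover have "coprime 5 (pell_p k ^ 4)"
    using coprime_5_pell_p by simp
  ultimately have "coprime 5 ?u"
    by (metis cong_imp_coprime cong_sym coprime_commute)
  then have "coprime (5 ^ m) ?u" by simp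
  then show ?thesis
    unfolding pell_q_times5 by (simp add: mult.assoc coprime_dvd_mult_left_iff)
qed

lemma five_power_dvd_pell_q_iff: "5 ^ m dvd pell_q k \<longleftrightarrow> 5 ^ m dvd k"
proof (induction m arbitrary: k)
  case (Suc m)
  show ?case
  proof (cases "5 dvd k")
    case True
    then obtain j where "k = 5 * j" by blast
    then show ?thesis
      using Suc[of j] by (simp only: five_power_dvd_pell_q_times5_iff) simp
  next
    case False
    then have "\<not> 5 dvd pell_q k" using five_dvd_pell_q_imp by blast
    then show ?thesis using False by (meson dvd_power dvd_trans zero_less_Suc)
  qed
qed simp

text \<open>Signs of \<open>a\<close> and \<open>b\<close> are arbitrary because the lower bound
  concerns all integer tuples.\<close>

lemma pell_p_le_abs_solution:
  fixes b a :: int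
  assumes "b\<^sup>2 + 1 = 5 * (5 ^ m * a)\<^sup>2"
  shows "pell_p (5 ^ m) \<le> \<bar>b\<bar>"
proof -
  have "\<bar>\<bar>b\<bar>\<^sup>2 - 5 * \<bar>5 ^ m * a\<bar>\<^sup>2\<bar> = 1"
    unfolding power2_abs assms[symmetric] by simp
  then obtain k where k: "\<bar>b\<bar> = pell_p k" "\<bar>5 ^ m * a\<bar> = pell_q k"
    using pell_solution_exists_index[of "\<bar>b\<bar>" "\<bar>5 ^ m * a\<bar>"] by auto
  \<comment> \<open>The norm excludes \<open>k = 0\<close>, the one multiple of \<open>5 ^ m\<close>
    below \<open>5 ^ m\<close>.\<close>
  have "(-1) ^ k = (-1::int)"
    using pell_norm[of k] assms unfolding k[symmetric] power2_abs by linarith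
  then have "k \<noteq> 0" by (intro notI) simp
  moreover have "5 ^ m dvd pell_q k"
    unfolding k(2)[symmetric] by simp
  then have "5 ^ m dvd k" by (simp only: five_power_dvd_pell_q_iff)
  ultimately have "5 ^ m \<le> k" by (intro dvd_imp_le) auto
  then show ?thesis
    using k(1) strict_mono_less_eq[OF strict_mono_pell_p] by simp
qed

section \<open>Translation between the system and the Pell equation\<close>

lemma solves_system_squares:
  assumes "solves_system n x" "i \<le> n"
  shows "x (Suc i) = 5 ^ 2 ^ i"
  using assms(2)
proof (induction i)
  case 0
  then show ?case using assms(1) by (auto simp: solves_system_def)
next
  case (Suc i)
  then have "Suc i \<in> {1..n}" by simp
  then have "x (Suc (Suc i)) = x (Suc i) * x (Suc i)"
    using assms(1) unfolding solves_system_def by (metis Suc_eq_plus1)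
  then show ?case using Suc by (simp add: power_add[symmetric] mult_2)
qed

lemma square_power_2_pred: "n > 0 \<Longrightarrow> (c ^ 2 ^ (n - 1))\<^sup>2 = (c::int) ^ 2 ^ n"
  by (cases n) (simp_all add: power_mult[symmetric] mult.commute)

text \<open>Equating the two expressions for \<open>x (n + 10)\<close> gives the equation; as
  \<open>2 ^ n\<close> is even, \<open>5 ^ 2 ^ n\<close> is a square and moves inside the
  bracket.\<close>

lemma solves_system_imp_pell:
  assumes "solves_system n x" "n > 0"
  shows "(x (n + 8))\<^sup>2 + 1 = 5 * (5 ^ 2 ^ (n - 1) * x (n + 6))\<^sup>2"
    and "x (n + 10) = (x (n + 8))\<^sup>2 + 1"
proof -
  have e: "x 1 = 5" "x (n + 1) = 5 ^ 2 ^ n"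
    using solves_system_squares[OF assms(1), of 0] solves_system_squares[OF assms(1), of n] by auto
  show 2: "x (n + 10) = (x (n + 8))\<^sup>2 + 1"
    using assms(1) by (simp add: solves_system_def power2_eq_square)
  have "x (n + 10) = x 1 * x (n + 1) * (x (n + 6))\<^sup>2"
    using assms(1) by (simp add: solves_system_def power2_eq_square)
  then show "(x (n + 8))\<^sup>2 + 1 = 5 * (5 ^ 2 ^ (n - 1) * x (n + 6))\<^sup>2"
    unfolding e using 2 by (simp only: power_mult_distrib square_power_2_pred[OF assms(2)] mult.assoc)
qed

text \<open>The free parameters are entries \<open>n + 6\<close> and \<open>n + 8\<close>. The list
  starts at entry \<open>n + 2\<close>, and the restricted abstraction provides the extensionality
  required by \<open>tuples\<close>.\<close>

definition pell_tuple :: "nat \<Rightarrow> int \<Rightarrow> int \<Rightarrow> nat \<Rightarrow> int" where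
  "pell_tuple n a b = (\<lambda>i\<in>{1..n + 10}.
     if i \<le> n + 1 then 5 ^ 2 ^ (i - 1)
     else [5 * 5 ^ 2 ^ n, 1, 2, 4, a, a\<^sup>2, b, b\<^sup>2, b\<^sup>2 + 1] ! (i - (n + 2)))"

lemma pell_tuple_in_tuples:
  assumes "a \<ge> 0" "b \<ge> 0"
  shows "pell_tuple n a b \<in> tuples (n + 10) {0..}"
proof -
  have "\<forall>y\<in>set [5 * 5 ^ 2 ^ n, 1, 2, 4, a, a\<^sup>2, b, b\<^sup>2, b\<^sup>2 + 1]. y \<ge> 0"
    using assms by simp
  moreover have "i - (n + 2) < 9" if "i \<in> {1..n + 10}" for i
    using that by auto
  ultimately show ?thesis
    unfolding tuples_def pell_tuple_def
    by (auto simp del: set_simps simp: restrict_PiE_iff list_all_iff intro!: nth_mem)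
qed

lemma solves_system_pell_tuple:
  assumes "n > 0" and "b\<^sup>2 + 1 = 5 * (5 ^ 2 ^ (n - 1) * a)\<^sup>2"
  shows "solves_system n (pell_tuple n a b)"
proof -
  let ?x = "pell_tuple n a b"
  have low: "?x i = 5 ^ 2 ^ (i - 1)" if "1 \<le> i" "i \<le> n + 1" for i
    using that by (simp add: pell_tuple_def)
  have high: "?x (n + 2) = 5 * 5 ^ 2 ^ n" "?x (n + 3) = 1" "?x (n + 4) = 2" "?x (n + 5) = 4"
    "?x (n + 6) = a" "?x (n + 7) = a\<^sup>2" "?x (n + 8) = b" "?x (n + 9) = b\<^sup>2"
    "?x (n + 10) = b\<^sup>2 + 1"
    by (simp_all add: pell_tuple_def)
  have "?x i * ?x i = ?x (i + 1)" if "i \<in> {1..n}" for i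
    using that square_power_2_pred[of i 5] by (simp add: low power2_eq_square)
  moreover have "?x 1 = 5" "?x (n + 1) = 5 ^ 2 ^ n"
    by (simp_all add: low)
  moreover have "5 * 5 ^ 2 ^ n * a\<^sup>2 = b\<^sup>2 + 1"
    unfolding assms(2) power_mult_distrib square_power_2_pred[OF assms(1)] by (rule mult.assoc)
  ultimately show ?thesis
    unfolding solves_system_def high by (simp only: power2_eq_square) simp
qed

lemma infinite_pell_solutions:
  "infinite ({(a, b). a \<ge> 0 \<and> b \<ge> 0 \<and> b\<^sup>2 + 1 = 5 * (5 ^ m * a)\<^sup>2} :: (int \<times> int) set)" (is "infinite ?S")
proof -
  \<comment> \<open>The factor \<open>5 ^ m\<close> makes the division in \<open>f\<close> exact,
    and oddness gives norm -1.\<close>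
  define k where "k t = 5 ^ m * (2 * t + 1)" for t :: nat
  define f where "f t = (pell_q (k t) div 5 ^ m, pell_p (k t))" for t
  have "inj f"
    using strict_mono_eq[OF strict_mono_pell_p] by (auto simp: inj_def f_def k_def)
  moreover have "f t \<in> ?S" for t
  proof -
    have "5 ^ m dvd pell_q (k t)"
      unfolding five_power_dvd_pell_q_iff by (simp add: k_def)
    moreover have "odd (k t)" by (simp add: k_def)
    ultimately show ?thesis
      using pell_norm[of "k t"] pell_p_pos[of "k t"] pell_q_nonneg[of "k t"]
      by (simp add: f_def pos_imp_zdiv_nonneg_iff)
  qed
  then have "range f \<subseteq> ?S" by (rule image_subsetI)
  ultimately show ?thesis
    unfolding infinite_iff_countable_subset by (intro exI[of _ f] conjI)
qed

theorem theorem4: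
  fixes n :: nat
  assumes "n > 0"
  shows "infinite {x \<in> tuples (n + 10) {0..}. solves_system n x} \<and>
    (\<forall>x \<in> tuples (n + 10) UNIV. solves_system n x \<longrightarrow>
      real_of_int (x (n + 10)) \<ge>
        (((2 + sqrt 5) ^ (5 ^ (2 ^ (n - 1))) + (2 - sqrt 5) ^ (5 ^ (2 ^ (n - 1)))) / 2)\<^sup>2 + 1)"
proof (intro conjI ballI impI)
  let ?S = "{(a, b). a \<ge> 0 \<and> b \<ge> 0 \<and> b\<^sup>2 + 1 = 5 * (5 ^ 2 ^ (n - 1) * a)\<^sup>2} :: (int \<times> int) set"
  have "a = a' \<and> b = b'" if "pell_tuple n a b = pell_tuple n a' b'" for a b a' b'
    using fun_cong[OF that, of "n + 6"] fun_cong[OF that, of "n + 8"]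
    by (simp add: pell_tuple_def)
  then have "inj_on (\<lambda>(a, b). pell_tuple n a b) ?S"
    by (auto simp: inj_on_def)
  then have "infinite ((\<lambda>(a, b). pell_tuple n a b) ` ?S)"
    using infinite_pell_solutions by (simp only: finite_image_iff) simp
  moreover have "(\<lambda>(a, b). pell_tuple n a b) ` ?S \<subseteq> {x \<in> tuples (n + 10) {0..}. solves_system n x}"
    using pell_tuple_in_tuples solves_system_pell_tuple[OF assms] by auto
  ultimately show "infinite {x \<in> tuples (n + 10) {0..}. solves_system n x}"
    using finite_subset by blast
next
  fix x assume "solves_system n x"
  note x = solves_system_imp_pell[OF this assms]
  \<comment> \<open>Squaring removes the absolute value, since \<open>x (n + 8)\<close> may be
    negative.\<close>
  have "(pell_p (5 ^ 2 ^ (n - 1)))\<^sup>2 \<le> (x (n + 8))\<^sup>2"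
    using pell_p_le_abs_solution[OF x(1)] pell_p_pos
    by (metis abs_le_square_iff abs_of_pos)
  then have "real_of_int ((pell_p (5 ^ 2 ^ (n - 1)))\<^sup>2 + 1) \<le> real_of_int (x (n + 10))"
    unfolding x(2) by (simp only: of_int_le_iff add_le_cancel_right)
  then show "real_of_int (x (n + 10)) \<ge>
      (((2 + sqrt 5) ^ (5 ^ (2 ^ (n - 1))) + (2 - sqrt 5) ^ (5 ^ (2 ^ (n - 1)))) / 2)\<^sup>2 + 1"
    by (simp only: pell_p_closed_form[symmetric] of_int_add of_int_power of_int_1)
qed

end
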